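(* Consider the reference-spectrum observation model described in the context, for a receiver array with $N\ge 2$ elements, at a base scene state $\mathbf p_0$ and with admissible pose set $\Xi$. Then for every pose $\boldsymbol\xi_i\in\Xi$ the effective Jacobian $\overline{\mathbf J}_i=\overline{\mathbf J}(\mathbf p_0,\boldsymbol\xi_i)$ satisfies $$\operatorname{rank}\overline{\mathbf J}_i\le N-1,$$ and the minimum number $M^\star=M^\star(\mathbf p_0)$ of references needed to span the locally observable scene subspace, whose dimension is $r_\star=r_\star(\mathbf p_0)$, satisfies $$M^\star\ge\left\lceil\frac{r_\star}{N-1}\right\rceil .$$
   Context: Array and spectrum map. The angular grid is a finite set $\mathcal G$ of $HW$ directions; $\mathbf a(\Omega)\in\mathbb C^N$ is a fixed steering vector and $g(\Omega)\ge 0$ a fixed element power pattern for each $\Omega\in\mathcal G$. For a phase vector $\boldsymbol\phi\in\mathbb R^N$ put $\widetilde{\mathbf x}(\boldsymbol\phi)=(e^{j\phi_1},\dots,e^{j\phi_N})^{\mathsf T}$ and $P_{\boldsymbol\phi}(\Omega)=g(\Omega)\,|\mathbf a(\Omega)^{\mathsf H}\widetilde{\mathbf x}(\boldsymbol\phi)|^2$ (up to a fixed positive scale factor). For $\boldsymbol\phi$ such that $\sqrt{P_{\boldsymbol\phi}}$ is nonconstant on $\mathcal G$, let $\mathcal H(\boldsymbol\phi)\in\mathbb R^{HW}$ be the vectorized spatial spectrum obtained by taking the pointwise square root $S=\sqrt{P_{\boldsymbol\phi}}$ and then min-max normalizing, $S\mapsto (S-\min S)/(\max S-\min S)$. Observation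 model. $\mathbf p\in\mathbb R^{d_{\mathrm p}}$ is a local parameterization of the scene state and $\boldsymbol\xi\in\Xi\subset\mathbb R^{d_\pi}$ is the (unknown) pose of a reference; the reference spectrum is $\mathcal F(\mathbf p,\boldsymbol\xi)\in\mathbb R^{HW}$, defined in a neighborhood of each point $(\mathbf p_0,\boldsymbol\xi)$, $\boldsymbol\xi\in\Xi$. Near each such point the map factors as $\mathcal F(\mathbf p,\boldsymbol\xi)=\mathcal H(\boldsymbol\phi(\mathbf p,\boldsymbol\xi))$ for a phase map $\boldsymbol\phi(\cdot,\cdot)\in\mathbb R^N$ that is differentiable at $(\mathbf p_0,\boldsymbol\xi)$, with $\mathcal H$ differentiable at $\boldsymbol\phi(\mathbf p_0,\boldsymbol\xi)$ (in particular the spectrum there has nonzero range). The poses of different references can vary independently. Effective Jacobian. For $\boldsymbol\xi\in\Xi$ let $\mathbf J_{\mathrm p}=D_{\mathbf p}\mathcal F(\mathbf p_0,\boldsymbol\xi)$ and $\mathbf J_{\xi}=D_{\boldsymbol\xi}\mathcal F(\mathbf p_0,\boldsymbol\xi)$, and define $$\overline{\mathbf J}(\mathbf p_0,\boldsymbol\xi)=\left(\mathbf I-\mathbf J_\xi\mathbf J_\xi^{\dagger}\right)\mathbf J_{\mathrm p},$$ where $\dagger$ is the Moore--Penrose pseudoinverse. For a finite reference configuration $\mathcal C=\{\boldsymbol\xi_1,\dots,\boldsymbol\xi_M\}\subset\Xi$, $\overline{\mathbf J}_{\mathcal C}$ is the matrix obtained by stacking the blocks $\overline{\mathbf J}(\mathbf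 p_0,\boldsymbol\xi_1),\dots,\overline{\mathbf J}(\mathbf p_0,\boldsymbol\xi_M)$ vertically (rank $0$ for the empty configuration). Observable dimension and minimum budget. $r_\star(\mathbf p_0)=\dim\operatorname{span}\{\operatorname{row}\overline{\mathbf J}(\mathbf p_0,\boldsymbol\xi):\boldsymbol\xi\in\Xi\}$, where $\operatorname{row}$ denotes the row space, and $$M^\star(\mathbf p_0)=\min\left\{|\mathcal C|:\ \mathcal C\subset\Xi \text{ finite},\ \operatorname{rank}\overline{\mathbf J}_{\mathcal C}=r_\star(\mathbf p_0)\right\}.$$ *)

theory Defs
  imports "HOL-Analysis.Analysis"
begin

section \<open>Array response and spectrum map\<close>

text \<open>The type \<open>'g\<close> is the finite grid of directions (so \<open>real ^ 'g\<close> is the space of vectorized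
  spectra) and the type \<open>'n\<close> indexes the array elements.\<close>

definition phasor :: "real ^ 'n \<Rightarrow> complex ^ 'n" where
  "phasor \<phi> = (\<chi> k. cis (\<phi> $ k))"

text \<open>\<open>c\<close> is the scale factor, \<open>g\<close> the element power pattern and \<open>a\<close> the steering vector.\<close>

definition power_spectrum ::
  "real \<Rightarrow> ('g \<Rightarrow> real) \<Rightarrow> ('g \<Rightarrow> complex ^ 'n) \<Rightarrow> real ^ 'n \<Rightarrow> 'g \<Rightarrow> real" where
  "power_spectrum c g a \<phi> \<Omega> = c * g \<Omega> * (cmod (\<Sum>k\<in>UNIV. cnj (a \<Omega> $ k) * phasor \<phi> $ k))\<^sup>2"

definition amplitude_spectrum ::
  "real \<Rightarrow> ('g::finite \<Rightarrow> real) \<Rightarrow> ('g \<Rightarrow> complex ^ 'n) \<Rightarrow> real ^ 'n \<Rightarrow> real ^ 'g" where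
  "amplitude_spectrum c g a \<phi> = (\<chi> \<Omega>. sqrt (power_spectrum c g a \<phi> \<Omega>))"

definition nonconstant_spectrum :: "real ^ 'g \<Rightarrow> bool" where
  "nonconstant_spectrum S \<longleftrightarrow> (\<exists>\<Omega> \<Omega>'. S $ \<Omega> \<noteq> S $ \<Omega>')"

definition min_max_normalize :: "real ^ 'g \<Rightarrow> real ^ 'g" where
  "min_max_normalize S =
     (\<chi> \<Omega>. (S $ \<Omega> - Min (range (($) S))) / (Max (range (($) S)) - Min (range (($) S))))"

text \<open>Meaningful only at \<open>\<phi>\<close> with nonconstant amplitude spectrum; the set of such \<open>\<phi>\<close> is open, so
  differentiability there does not depend on the values of the totalized function elsewhere.\<close>

definition spectrum_map ::
  "real \<Rightarrow> ('g::finite \<Rightarrow> real) \<Rightarrow> ('g \<Rightarrow> complex ^ 'n) \<Rightarrow> real ^ 'n \<Rightarrow> real ^ 'g" where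
  "spectrum_map c g a \<phi> = min_max_normalize (amplitude_spectrum c g a \<phi>)"

section \<open>Moore--Penrose pseudoinverse\<close>

definition is_pseudoinverse :: "real ^ 'n ^ 'm \<Rightarrow> real ^ 'm ^ 'n \<Rightarrow> bool" where
  "is_pseudoinverse A X \<longleftrightarrow>
     A ** X ** A = A \<and> X ** A ** X = X \<and>
     transpose (A ** X) = A ** X \<and> transpose (X ** A) = X ** A"

definition pseudoinverse :: "real ^ 'n ^ 'm \<Rightarrow> real ^ 'm ^ 'n" where
  "pseudoinverse A = (THE X. is_pseudoinverse A X)"

lemma is_pseudoinverse_unique:
  assumes X: "is_pseudoinverse A X" and Y: "is_pseudoinverse A Y"
  shows "X = Y"
proof -
  have x: "A ** X ** A = A" "X ** A ** X = X" "transpose (A ** X) = A ** X" "transpose (X ** A) = X ** A"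
    and y: "A ** Y ** A = A" "Y ** A ** Y = Y" "transpose (A ** Y) = A ** Y" "transpose (Y ** A) = Y ** A"
    using X Y by (auto simp: is_pseudoinverse_def)
  have "A ** X = (A ** Y) ** (A ** X)"
    by (simp add: matrix_mul_assoc y(1))
  then have "transpose (A ** X) = transpose (A ** X) ** transpose (A ** Y)"
    by (metis matrix_transpose_mul)
  then have ax: "A ** X = A ** Y"
    by (simp add: x(3) y(3) matrix_mul_assoc x(1))
  have "X ** A = (X ** A) ** (Y ** A)"
    by (metis matrix_mul_assoc y(1))
  then have "transpose (X ** A) = transpose (Y ** A) ** transpose (X ** A)"
    by (metis matrix_transpose_mul)
  then have xa: "X ** A = Y ** A"
    by (metis x(1,4) y(4) matrix_mul_assoc)
  show ?thesis
    by (metis ax xa x(2) y(2) matrix_mul_assoc)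
qed

lemma orthogonal_projection_matrix:
  fixes S :: "(real ^ 'n) set"
  assumes "subspace S"
  obtains P :: "real ^ 'n ^ 'n"
  where "transpose P = P" "\<And>x. P *v x \<in> S" "\<And>x. x \<in> S \<Longrightarrow> P *v x = x"
proof -
  obtain B where B: "B \<subseteq> S" "pairwise orthogonal B" "\<And>x. x \<in> B \<Longrightarrow> norm x = 1"
      "independent B" "span B = S"
    using orthonormal_basis_subspace[OF assms] by metis
  have fin: "finite B"
    using B(4) independent_bound by blast
  define f where "f x = (\<Sum>b\<in>B. (b \<bullet> x) *\<^sub>R b)" for x
  have lin: "linear f"
    by (rule linearI)
      (simp_all add: f_def inner_add_right scaleR_add_left sum.distrib scaleR_sum_right)
  have fS: "f x \<in> S" for x
    unfolding f_def using B(1) assms by (auto intro!: subspace_sum subspace_scale)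
  have fB: "f b = b" if "b \<in> B" for b
  proof -
    have "(b' \<bullet> b) *\<^sub>R b' = (if b' = b then b else 0)" if "b' \<in> B" for b'
      using B(2,3) \<open>b \<in> B\<close> that by (auto simp: pairwise_def orthogonal_def norm_eq_1)
    then have "f b = (\<Sum>b'\<in>B. if b' = b then b else 0)"
      unfolding f_def by (intro sum.cong) auto
    then show ?thesis
      using fin that by simp
  qed
  have fid: "f x = x" if "x \<in> S" for x
    using linear_eq_on_span[OF lin linear_id, of B x] fB B(5) that by auto
  have sym: "f x \<bullet> y = x \<bullet> f y" for x y
    unfolding f_def
    by (simp add: inner_sum_left inner_sum_right inner_commute mult.commute)
  have mv: "matrix f *v x = f x" for x
    by (simp add: lin matrix_works)
  have "transpose (matrix f) *v x = matrix f *v x" for x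
  proof -
    have "y \<bullet> (transpose (matrix f) *v x) = y \<bullet> (matrix f *v x)" for y
      by (metis dot_lmul_matrix inner_commute mv sym transpose_matrix_vector)
    then show ?thesis
      using vector_eq_ldot by blast
  qed
  then have "transpose (matrix f) = matrix f"
    by (simp add: matrix_eq)
  then show thesis
    using that mv fS fid by metis
qed

lemma is_pseudoinverse_exists: "\<exists>X. is_pseudoinverse (A :: real ^ 'n ^ 'm) X"
proof -
  let ?V = "span (rows A)" and ?f = "\<lambda>x. A *v x"
  obtain Q where Q: "transpose Q = Q" "\<And>x. Q *v x \<in> ?V" "\<And>x. x \<in> ?V \<Longrightarrow> Q *v x = x"
    using orthogonal_projection_matrix[OF subspace_span] by metis
  have "subspace (range ?f)"
    by (intro linear_subspace_image matrix_vector_mul_linear subspace_UNIV)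
  then obtain P where P: "transpose P = P" "\<And>x. P *v x \<in> range ?f"
      "\<And>x. x \<in> range ?f \<Longrightarrow> P *v x = x"
    using orthogonal_projection_matrix by metis
  have AQ: "A *v (Q *v x) = A *v x" for x
  proof -
    have "orthogonal r (x - Q *v x)" if "r \<in> ?V" for r
    proof -
      have "r \<bullet> (Q *v x) = (Q *v r) \<bullet> x"
        by (metis Q(1) dot_lmul_matrix transpose_matrix_vector)
      then show ?thesis
        using Q(3)[OF that] by (simp add: orthogonal_def inner_diff_right)
    qed
    moreover have "A $ i \<in> ?V" for i
      by (rule span_base) (auto simp: rows_def row_def)
    ultimately have "A $ i \<bullet> (x - Q *v x) = 0" for i
      by (simp add: orthogonal_def)
    then have "A *v (x - Q *v x) = 0"
      by (simp add: vec_eq_iff matrix_vector_mul_component)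
    then show ?thesis
      by (simp add: matrix_vector_mult_diff_distrib)
  qed
  have inj: "inj_on ?f ?V"
  proof (rule inj_onI)
    fix x y assume xy: "x \<in> ?V" "y \<in> ?V" "A *v x = A *v y"
    then have z: "x - y \<in> ?V" "A *v (x - y) = 0"
      by (auto simp: span_diff matrix_vector_mult_diff_distrib)
    then have "A $ i \<bullet> (x - y) = 0" for i
      by (metis matrix_vector_mul_component zero_index)
    then have "orthogonal (x - y) r" if "r \<in> rows A" for r
      using that by (auto simp: rows_def row_def orthogonal_def inner_commute)
    then have "orthogonal (x - y) (x - y)"
      using z(1) orthogonal_to_span by blast
    then show "x = y"
      by (simp add: orthogonal_def)
  qed
  obtain h where h: "linear h" "\<And>v. v \<in> ?V \<Longrightarrow> h (A *v v) = v" "range h \<subseteq> ?V"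
    using linear_exists_left_inverse_on[OF matrix_vector_mul_linear subspace_span inj]
    by metis
  define X where "X = matrix h ** P"
  have Xv: "X *v y = h (P *v y)" for y
    by (simp add: X_def h(1) matrix_works flip: matrix_vector_mul_assoc)
  have "X ** A = Q"
  proof -
    have "X *v (A *v x) = Q *v x" for x
      by (metis AQ P(3) Q(2) Xv h(2) rangeI)
    then show ?thesis
      by (simp add: matrix_eq flip: matrix_vector_mul_assoc)
  qed
  moreover have "A ** X = P"
  proof -
    have "A *v (X *v y) = P *v y" for y
    proof -
      obtain v where v: "P *v y = A *v v"
        using P(2)[of y] by auto
      then show ?thesis
        by (metis AQ Q(2) Xv h(2))
    qed
    then show ?thesis
      by (simp add: matrix_eq flip: matrix_vector_mul_assoc)
  qed
  moreover have "P ** A = A"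
    by (simp add: matrix_eq P(3) flip: matrix_vector_mul_assoc)
  moreover have "Q ** X = X"
    using h(3) by (auto simp: matrix_eq Xv intro!: Q(3) simp flip: matrix_vector_mul_assoc)
  ultimately have "is_pseudoinverse A X"
    by (simp add: is_pseudoinverse_def P(1) Q(1))
  then show ?thesis ..
qed

lemma is_pseudoinverse_pseudoinverse: "is_pseudoinverse A (pseudoinverse A)"
  unfolding pseudoinverse_def
  by (rule theI') (use is_pseudoinverse_exists is_pseudoinverse_unique in blast)

section \<open>Effective Jacobian, observable dimension and minimum reference budget\<close>

definition scene_jacobian ::
  "((real ^ 'p) \<times> (real ^ 'q) \<Rightarrow> real ^ 'g) \<Rightarrow> real ^ 'p \<Rightarrow> real ^ 'q \<Rightarrow> real ^ 'p ^ 'g" where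
  "scene_jacobian F p \<xi> = jacobian (\<lambda>p'. F (p', \<xi>)) (at p)"

definition pose_jacobian ::
  "((real ^ 'p) \<times> (real ^ 'q) \<Rightarrow> real ^ 'g) \<Rightarrow> real ^ 'p \<Rightarrow> real ^ 'q \<Rightarrow> real ^ 'q ^ 'g" where
  "pose_jacobian F p \<xi> = jacobian (\<lambda>\<xi>'. F (p, \<xi>')) (at \<xi>)"

definition effective_jacobian ::
  "((real ^ 'p) \<times> (real ^ 'q) \<Rightarrow> real ^ 'g) \<Rightarrow> real ^ 'p \<Rightarrow> real ^ 'q \<Rightarrow> real ^ 'p ^ 'g" where
  "effective_jacobian F p \<xi> =
     (mat 1 - pose_jacobian F p \<xi> ** pseudoinverse (pose_jacobian F p \<xi>)) ** scene_jacobian F p \<xi>"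

text \<open>The number of rows of the stacked matrix depends on the configuration, so that matrix is
  represented by its rows, indexed by \<open>C \<times> UNIV\<close>, and its rank is the dimension of its set of rows
  (the definition of \<^const>\<open>rank\<close>). The lemma below confirms agreement with \<^const>\<open>rank\<close>
  for any enumeration of the configuration by a finite type.\<close>

definition stacked_row :: "('c \<Rightarrow> real ^ 'p ^ 'g) \<Rightarrow> 'c \<times> 'g \<Rightarrow> real ^ 'p" where
  "stacked_row J = (\<lambda>(\<xi>, i). row i (J \<xi>))"

definition stacked_rank :: "('c \<Rightarrow> real ^ 'p ^ 'g) \<Rightarrow> 'c set \<Rightarrow> nat" where
  "stacked_rank J C = dim (stacked_row J ` (C \<times> UNIV))"

lemma stacked_rank_eq_rank:
  fixes J :: "'c \<Rightarrow> real ^ 'p ^ 'g" and e :: "'m::finite \<Rightarrow> 'c"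
  assumes "range e = C"
  shows "stacked_rank J C = rank (\<chi> k :: 'm \<times> 'g. row (snd k) (J (e (fst k))))"
proof -
  have "stacked_row J ` (C \<times> UNIV) = rows (\<chi> k :: 'm \<times> 'g. row (snd k) (J (e (fst k))))"
    unfolding assms[symmetric] by (force simp: stacked_row_def rows_def row_def)
  then show ?thesis
    by (simp add: stacked_rank_def row_rank_def)
qed

lemma stacked_rank_empty: "stacked_rank J {} = 0"
  by (simp add: stacked_rank_def)

definition observable_dim ::
  "((real ^ 'p) \<times> (real ^ 'q) \<Rightarrow> real ^ 'g) \<Rightarrow> real ^ 'p \<Rightarrow> (real ^ 'q) set \<Rightarrow> nat" where
  "observable_dim F p \<Xi> = dim (span (\<Union>\<xi>\<in>\<Xi>. span (rows (effective_jacobian F p \<xi>))))"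

definition min_budget ::
  "((real ^ 'p) \<times> (real ^ 'q) \<Rightarrow> real ^ 'g) \<Rightarrow> real ^ 'p \<Rightarrow> (real ^ 'q) set \<Rightarrow> nat" where
  "min_budget F p \<Xi> =
     (LEAST m. \<exists>C. finite C \<and> C \<subseteq> \<Xi> \<and> card C = m \<and>
        stacked_rank (effective_jacobian F p) C = observable_dim F p \<Xi>)"

end

theory Submission
  imports Defs
begin

text \<open>A global phase shift leaves every \<open>\<bar>a(\<Omega>)\<^sup>H x\<bar>\<close> unchanged, so the derivative of the
  spectrum map annihilates the all-ones vector and has rank at most \<open>N - 1\<close>. By the chain rule the
  scene Jacobian, and hence the effective Jacobian, factors through it. Subadditivity of the rank
  under stacking then bounds the number of references from below.\<close>

text \<open>Here \<open>1\<close> is the all-ones vector, so every array sum acquires the same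
  unimodular factor \<open>cis t\<close>, which the modulus discards before square root and
  normalization are applied.\<close>

lemma spectrum_map_global_phase:
  "spectrum_map c g a (\<phi> + t *\<^sub>R 1) = spectrum_map c g a \<phi>"
proof -
  have "phasor (\<phi> + t *\<^sub>R 1) $ k = cis t * phasor \<phi> $ k" for k
    by (simp add: phasor_def cis_mult add.commute)
  then have "(\<Sum>k\<in>UNIV. cnj (a \<Omega> $ k) * phasor (\<phi> + t *\<^sub>R 1) $ k)
      = cis t * (\<Sum>k\<in>UNIV. cnj (a \<Omega> $ k) * phasor \<phi> $ k)" for \<Omega>
    by (simp add: sum_distrib_left mult.left_commute)
  then show ?thesis
    by (simp add: spectrum_map_def amplitude_spectrum_def power_spectrum_def norm_mult)
qed

lemma spectrum_map_derivative_one: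
  assumes "(spectrum_map c g a has_derivative L) (at \<phi>)"
  shows "L 1 = 0"
proof -
  have "((\<lambda>t::real. \<phi> + t *\<^sub>R 1) has_derivative (\<lambda>t. t *\<^sub>R 1)) (at 0)"
    by (auto intro!: derivative_eq_intros)
  \<comment> \<open>The base point is rewritten as the value of the line at \<open>0\<close>, the
    form in which the chain rule expects it.\<close>
  moreover have "(spectrum_map c g a has_derivative L) (at (\<phi> + 0 *\<^sub>R 1))"
    using assms by simp
  ultimately have "((\<lambda>t::real. spectrum_map c g a (\<phi> + t *\<^sub>R 1)) has_derivative (\<lambda>t. L (t *\<^sub>R 1))) (at 0)"
    by (rule has_derivative_compose)
  then have "(\<lambda>t::real. L (t *\<^sub>R 1)) = (\<lambda>t. 0)"
    by (intro has_derivative_unique[of "\<lambda>t. spectrum_map c g a \<phi>" _ 0])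
      (simp_all add: spectrum_map_global_phase)
  then show ?thesis
    by (metis scaleR_one)
qed

text \<open>A nonzero kernel vector excludes injectivity, hence full column rank.\<close>

lemma rank_less_ncols:
  fixes A :: "real ^ 'n ^ 'm"
  assumes "A *v x = 0" "x \<noteq> 0"
  shows "rank A \<le> CARD('n) - 1"
proof -
  have "\<not> inj ((*v) A)"
    using assms by (metis injD matrix_vector_mult_0_right)
  then have "rank A \<noteq> CARD('n)"
    using full_rank_injective by blast
  moreover have "rank A \<le> CARD('n)"
    using rank_bound[of A] by simp
  ultimately show ?thesis
    by simp
qed

lemma rank_scene_jacobian_le:
  fixes F :: "(real ^ 'p) \<times> (real ^ 'q) \<Rightarrow> real ^ 'g"
    and \<phi> :: "(real ^ 'p) \<times> (real ^ 'q) \<Rightarrow> real ^ 'n"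
  assumes \<phi>: "\<phi> differentiable at (p, \<xi>)"
    and H: "spectrum_map c g a differentiable at (\<phi> (p, \<xi>))"
    and F: "\<forall>\<^sub>F x in nhds (p, \<xi>). F x = spectrum_map c g a (\<phi> x)"
  shows "rank (scene_jacobian F p \<xi>) \<le> CARD('n) - 1"
proof -
  obtain D where D: "(\<phi> has_derivative D) (at (p, \<xi>))"
    using \<phi> by (auto simp: differentiable_def)
  obtain L where L: "(spectrum_map c g a has_derivative L) (at (\<phi> (p, \<xi>)))"
    using H by (auto simp: differentiable_def)
  have "((\<lambda>x. spectrum_map c g a (\<phi> x)) has_derivative (\<lambda>h. L (D h))) (at (p, \<xi>))"
    using D L by (rule has_derivative_compose)
  \<comment> \<open>The factorization is only local; transferring the derivative to \<open>F\<close>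
    takes agreement on a punctured neighborhood and at the point itself.\<close>
  moreover have "\<forall>\<^sub>F x in at (p, \<xi>). spectrum_map c g a (\<phi> x) = F x"
    using F by (auto simp: eventually_at_filter elim: eventually_mono)
  moreover have "F (p, \<xi>) = spectrum_map c g a (\<phi> (p, \<xi>))"
    using F by (rule eventually_nhds_x_imp_x)
  ultimately have "(F has_derivative (\<lambda>h. L (D h))) (at (p, \<xi>))"
    by (intro has_derivative_transform_eventually[where g = F]) auto
  \<comment> \<open>Freezing the pose turns the joint derivative into the partial derivative in the
    scene state.\<close>
  moreover have "((\<lambda>p'. (p', \<xi>)) has_derivative (\<lambda>h. (h, 0))) (at p)"
    by (auto intro!: derivative_eq_intros)
  ultimately have "((\<lambda>p'. F (p', \<xi>)) has_derivative (\<lambda>h. L (D (h, 0)))) (at p)"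
    by (rule has_derivative_compose[rotated])
  then have "frechet_derivative (\<lambda>p'. F (p', \<xi>)) (at p) = L \<circ> (\<lambda>h. D (h, 0))"
    by (simp add: comp_def frechet_derivative_at[symmetric])
  moreover have "linear L" "linear (\<lambda>h. D (h, 0))"
  proof -
    show "linear L"
      using L by (rule has_derivative_linear)
    have "linear D"
      using D by (rule has_derivative_linear)
    moreover have "linear (\<lambda>h::real^'p. (h, 0::real^'q))"
      by (rule linearI) auto
    ultimately show "linear (\<lambda>h. D (h, 0))"
      using linear_compose[of "\<lambda>h. (h, 0)" D] by (simp add: comp_def)
  qed
  \<comment> \<open>The intermediate space is the phase space, so the left factor has one column per
    array element and kills the all-ones vector.\<close>
  ultimately have "scene_jacobian F p \<xi> = matrix L ** matrix (\<lambda>h. D (h, 0))"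
    by (simp add: scene_jacobian_def jacobian_def matrix_compose)
  then have "rank (scene_jacobian F p \<xi>) \<le> rank (matrix L)"
    by (simp add: rank_mul_le_left)
  also have "\<dots> \<le> CARD('n) - 1"
    using spectrum_map_derivative_one[OF L] \<open>linear L\<close>
    by (intro rank_less_ncols[of _ 1]) (simp_all add: matrix_works)
  finally show ?thesis .
qed

text \<open>The union of a basis for each set spans both.\<close>

lemma dim_Un_le: "dim (A \<union> B) \<le> dim A + dim (B :: 'a::euclidean_space set)"
proof -
  obtain A' where A': "independent A'" "A \<subseteq> span A'" "card A' = dim A"
    using basis_exists by metis
  obtain B' where B': "independent B'" "B \<subseteq> span B'" "card B' = dim B"
    using basis_exists by metis
  have "A \<union> B \<subseteq> span (A' \<union> B')"
    using A'(2) B'(2) span_mono[of A' "A' \<union> B'"] span_mono[of B' "A' \<union> B'"] by blast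
  moreover have "finite (A' \<union> B')"
    using A'(1) B'(1) independent_bound by blast
  ultimately have "dim (A \<union> B) \<le> card (A' \<union> B')"
    by (rule dim_le_card)
  also have "\<dots> \<le> dim A + dim B"
    using card_Un_le[of A' B'] A'(3) B'(3) by simp
  finally show ?thesis .
qed

lemma stacked_row_image:
  "stacked_row J ` (C \<times> UNIV) = (\<Union>\<xi>\<in>C. rows (J \<xi>))"
  by (force simp: stacked_row_def rows_def)

lemma stacked_rank_le:
  assumes "finite C" "\<And>\<xi>. \<xi> \<in> C \<Longrightarrow> rank (J \<xi>) \<le> n"
  shows "stacked_rank J C \<le> card C * n"
  using assms
proof (induction C)
  case empty
  then show ?case
    by (simp add: stacked_rank_empty)
next
  case (insert \<xi> C)
  have "stacked_rank J (insert \<xi> C) \<le> rank (J \<xi>) + stacked_rank J C"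
    unfolding stacked_rank_def stacked_row_image row_rank_def using dim_Un_le by simp
  with insert show ?case
    by fastforce
qed

text \<open>This lets a basis of the observable subspace be picked among the Jacobian rows
  themselves, each of which belongs to some pose.\<close>

lemma span_UN_span: "span (\<Union>x\<in>X. span (f x)) = span (\<Union>x\<in>X. f x)"
proof (rule subset_antisym)
  have "span (f x) \<subseteq> span (\<Union>x\<in>X. f x)" if "x \<in> X" for x
    using that by (intro span_mono) blast
  then show "span (\<Union>x\<in>X. span (f x)) \<subseteq> span (\<Union>x\<in>X. f x)"
    by (intro span_minimal subspace_span) blast
  show "span (\<Union>x\<in>X. f x) \<subseteq> span (\<Union>x\<in>X. span (f x))"
    by (intro span_mono UN_mono span_superset subset_refl)
qed

text \<open>Even for infinite \<open>\<Xi>\<close>, a basis made of rows is finite and therefore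
  involves only finitely many poses.\<close>

lemma observable_dim_attained:
  obtains C where "finite C" "C \<subseteq> \<Xi>"
    "stacked_rank (effective_jacobian F p) C = observable_dim F p \<Xi>"
proof -
  let ?R = "\<lambda>\<xi>. rows (effective_jacobian F p \<xi>)"
  have obs: "observable_dim F p \<Xi> = dim (\<Union>\<xi>\<in>\<Xi>. ?R \<xi>)"
    unfolding observable_dim_def span_UN_span by (rule dim_span)
  obtain B where B: "B \<subseteq> (\<Union>\<xi>\<in>\<Xi>. ?R \<xi>)" "independent B" "card B = observable_dim F p \<Xi>"
    using basis_exists obs by metis
  have "finite B"
    using B(2) independent_bound by blast
  then obtain \<R> where "finite \<R>" "\<R> \<subseteq> ?R ` \<Xi>" "B \<subseteq> \<Union>\<R>"
    using finite_subset_Union B(1) by blast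
  moreover from this obtain C where C: "C \<subseteq> \<Xi>" "finite C" "\<R> = ?R ` C"
    using finite_subset_image by metis
  ultimately have BC: "B \<subseteq> (\<Union>\<xi>\<in>C. ?R \<xi>)"
    by blast
  \<comment> \<open>The dimension over \<open>C\<close> is squeezed between \<open>card B\<close>
    and the dimension over \<open>\<Xi>\<close>, which coincide.\<close>
  have "dim (\<Union>\<xi>\<in>C. ?R \<xi>) \<le> dim (\<Union>\<xi>\<in>\<Xi>. ?R \<xi>)"
    using C(1) by (intro dim_subset) blast
  moreover have "card B \<le> dim (\<Union>\<xi>\<in>C. ?R \<xi>)"
    using dim_subset[OF BC] dim_eq_card_independent[OF B(2)] by simp
  ultimately have "dim (\<Union>\<xi>\<in>C. ?R \<xi>) = observable_dim F p \<Xi>"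
    using B(3) obs by simp
  then show thesis
    using that C by (simp add: stacked_rank_def stacked_row_image)
qed

text \<open>Since some configuration is feasible, the \<open>LEAST\<close> in
  \<open>min_budget\<close> is a genuine minimum and has a witness.\<close>

lemma min_budget_attained:
  obtains C where "finite C" "C \<subseteq> \<Xi>" "card C = min_budget F p \<Xi>"
    "stacked_rank (effective_jacobian F p) C = observable_dim F p \<Xi>"
proof -
  define P where "P m \<longleftrightarrow> (\<exists>C. finite C \<and> C \<subseteq> \<Xi> \<and> card C = m \<and>
      stacked_rank (effective_jacobian F p) C = observable_dim F p \<Xi>)" for m
  have "\<exists>m. P m"
    unfolding P_def using observable_dim_attained[of \<Xi> F p] by metis
  then have "P (LEAST m. P m)"
    by (rule LeastI_ex)
  then have "P (min_budget F p \<Xi>)"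
    by (simp add: min_budget_def P_def)
  then show thesis
    using that by (auto simp: P_def)
qed

theorem proposition1:
  fixes c :: real
    and g :: "'g::finite \<Rightarrow> real"
    and a :: "'g \<Rightarrow> complex ^ 'n"
    and F :: "(real ^ 'p) \<times> (real ^ 'q) \<Rightarrow> real ^ 'g"
    and p0 :: "real ^ 'p"
    and \<Xi> :: "(real ^ 'q) set"
  assumes N: "CARD('n) \<ge> 2"
    and c: "c > 0"
    and g: "\<And>\<Omega>. g \<Omega> \<ge> 0"
    and model: "\<And>\<xi>. \<xi> \<in> \<Xi> \<Longrightarrow>
      \<exists>\<phi> :: (real ^ 'p) \<times> (real ^ 'q) \<Rightarrow> real ^ 'n.
        \<phi> differentiable at (p0, \<xi>) \<and>
        nonconstant_spectrum (amplitude_spectrum c g a (\<phi> (p0, \<xi>))) \<and>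
        spectrum_map c g a differentiable at (\<phi> (p0, \<xi>)) \<and>
        (\<forall>\<^sub>F x in nhds (p0, \<xi>). F x = spectrum_map c g a (\<phi> x))"
  shows "(\<forall>\<xi>\<in>\<Xi>. rank (effective_jacobian F p0 \<xi>) \<le> CARD('n) - 1) \<and>
    int (min_budget F p0 \<Xi>) \<ge> \<lceil>real (observable_dim F p0 \<Xi>) / (real CARD('n) - 1)\<rceil>"
proof
  show rank_le: "\<forall>\<xi>\<in>\<Xi>. rank (effective_jacobian F p0 \<xi>) \<le> CARD('n) - 1"
  proof
    fix \<xi> assume "\<xi> \<in> \<Xi>"
    then have "rank (scene_jacobian F p0 \<xi>) \<le> CARD('n) - 1"
      using model rank_scene_jacobian_le by blast
    then show "rank (effective_jacobian F p0 \<xi>) \<le> CARD('n) - 1"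
      \<comment> \<open>Eliminating the pose multiplies the scene Jacobian from the left, which
        cannot raise its rank.\<close>
      unfolding effective_jacobian_def using rank_mul_le_right order_trans by blast
  qed
  obtain C where C: "finite C" "C \<subseteq> \<Xi>" "card C = min_budget F p0 \<Xi>"
      "stacked_rank (effective_jacobian F p0) C = observable_dim F p0 \<Xi>"
    by (rule min_budget_attained)
  have "stacked_rank (effective_jacobian F p0) C \<le> card C * (CARD('n) - 1)"
    using C(1,2) rank_le by (intro stacked_rank_le) auto
  then have "real (observable_dim F p0 \<Xi>) \<le> real (min_budget F p0 \<Xi> * (CARD('n) - 1))"
    unfolding C(3,4) by (rule of_nat_mono)
  \<comment> \<open>\<open>N\<close> makes the natural-number subtraction agree with the real one,
    and next makes the divisor positive.\<close>
  then have "real (observable_dim F p0 \<Xi>) \<le> real (min_budget F p0 \<Xi>) * (real CARD('n) - 1)"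
    using N by (simp add: of_nat_diff)
  then have "real (observable_dim F p0 \<Xi>) / (real CARD('n) - 1) \<le> real (min_budget F p0 \<Xi>)"
    using N by (simp add: divide_le_eq)
  then show "int (min_budget F p0 \<Xi>) \<ge> \<lceil>real (observable_dim F p0 \<Xi>) / (real CARD('n) - 1)\<rceil>"
    by (simp add: ceiling_le_iff)
qed

end
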